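(* Let $c\in\mathbb C^4$ with $|c_k|>0$ for $k=1,2,3,4$. Define real numbers $$v_k=|c_k|\left(-2|c_k|^2+\sum_{i=1}^4|c_i|^2\right)+2\prod_{i\ne k}|c_i|,\qquad k=1,2,3,4.$$ Then: (i) either all of the $v_k$'s are positive or exactly one of them is non-positive; (ii) if one of the $v_k$'s is non-positive, then $\|c\|_{\mathsf X}'=\|c\|_\infty$; (iii) if the numbers $|c_1|,|c_2|,|c_3|,|c_4|$ do not make a quadrangle, then one of the $v_k$'s is non-positive.
   Context: On $\mathbb C^4$ define the norm $\|z\|_{\mathsf X}=\max_{\sigma\in\mathbb R}\left(|z_1e^{\mathrm i\sigma}+\bar z_4|+|z_2e^{\mathrm i\sigma}+\bar z_3|\right)$ and its dual norm $\|c\|_{\mathsf X}'=\max\{|\langle c,z\rangle|:\|z\|_{\mathsf X}=1\}$, where $\langle c,z\rangle=\sum_{i=1}^4c_iz_i$ (bilinear). Also $\|c\|_\infty=\max_{1\le j\le 4}|c_j|$. Four positive numbers "make a quadrangle" if they are the side lengths of a (non-degenerate) quadrangle, i.e. each is strictly less than the sum of the other three. *)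

theory Defs
  imports "HOL-Analysis.Analysis"
begin

text \<open>
  In the numeral type \<open>4\<close> one has \<open>4 = 0\<close>, so \<open>1, 2, 3, 4\<close> are its four distinct elements and
  \<open>z $ 1, \<dots>, z $ 4\<close> are the four coordinates of \<open>z :: complex ^ 4\<close>.
\<close>

definition normX_fun :: "complex ^ 4 \<Rightarrow> real \<Rightarrow> real" where
  "normX_fun z \<sigma> =
     cmod (z $ 1 * cis \<sigma> + cnj (z $ 4)) + cmod (z $ 2 * cis \<sigma> + cnj (z $ 3))"

text \<open>
  The two maxima below are written as suprema; lemmas \<open>normX_is_max\<close> and \<open>dual_normX_is_max\<close>
  show that they are attained.
\<close>

definition normX :: "complex ^ 4 \<Rightarrow> real" where
  "normX z = (SUP \<sigma>. normX_fun z \<sigma>)"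

definition pairing :: "complex ^ 4 \<Rightarrow> complex ^ 4 \<Rightarrow> complex" where
  "pairing c z = (\<Sum>i\<in>UNIV. c $ i * z $ i)"

definition dual_normX :: "complex ^ 4 \<Rightarrow> real" where
  "dual_normX c = (SUP z\<in>{z. normX z = 1}. cmod (pairing c z))"

text \<open>The library's \<open>infnorm\<close> on \<open>complex ^ 4\<close> takes real and imaginary parts separately.\<close>

definition norm_inf :: "complex ^ 4 \<Rightarrow> real" where
  "norm_inf c = Max (range (\<lambda>j. cmod (c $ j)))"

definition make_quadrangle :: "real ^ 4 \<Rightarrow> bool" where
  "make_quadrangle a \<longleftrightarrow> (\<forall>k. 0 < a $ k) \<and> (\<forall>k. a $ k < (\<Sum>i\<in>UNIV - {k}. a $ i))"

definition vX :: "complex ^ 4 \<Rightarrow> 4 \<Rightarrow> real" where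
  "vX c k = cmod (c $ k) * (- 2 * (cmod (c $ k))\<^sup>2 + (\<Sum>i\<in>UNIV. (cmod (c $ i))\<^sup>2))
           + 2 * (\<Prod>i\<in>UNIV - {k}. cmod (c $ i))"

lemma normX_fun_le: "normX_fun z \<sigma> \<le> cmod (z$1) + cmod (z$2) + cmod (z$3) + cmod (z$4)"
  unfolding normX_fun_def
  using norm_triangle_ineq[of "z$1 * cis \<sigma>" "cnj (z$4)"]
    norm_triangle_ineq[of "z$2 * cis \<sigma>" "cnj (z$3)"]
  by (simp add: norm_mult)

lemma bdd_normX_fun: "bdd_above (range (normX_fun z))"
  using normX_fun_le by (rule bdd_aboveI2)

lemma normX_fun_le_normX: "normX_fun z \<sigma> \<le> normX z"
  unfolding normX_def by (rule cSUP_upper[OF UNIV_I bdd_normX_fun])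

lemma normX_is_max: "\<exists>\<sigma>. normX z = normX_fun z \<sigma>"
proof -
  have "continuous_on {-pi..pi} (normX_fun z)"
    unfolding normX_fun_def by (intro continuous_intros)
  then obtain s where s: "\<forall>t\<in>{-pi..pi}. normX_fun z t \<le> normX_fun z s"
    using continuous_attains_sup[of "{-pi..pi}" "normX_fun z"] by auto
  have "normX_fun z t \<le> normX_fun z s" for t
  proof -
    have "Arg (cis t) \<in> {-pi..pi}" and "cis (Arg (cis t)) = cis t"
      using Arg_bounded[of "cis t"] by (auto simp: cis_Arg sgn_eq)
    moreover from this(2) have "normX_fun z (Arg (cis t)) = normX_fun z t"
      by (simp add: normX_fun_def)
    ultimately show ?thesis using s by metis
  qed
  then have "normX z \<le> normX_fun z s"
    unfolding normX_def by (intro cSUP_least) auto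
  then show ?thesis using normX_fun_le_normX[of z s] by (metis antisym)
qed

lemma normX_triangle: "normX (x + y) \<le> normX x + normX y"
proof -
  obtain s where s: "normX (x + y) = normX_fun (x + y) s" using normX_is_max by blast
  have "normX_fun (x + y) s \<le> normX_fun x s + normX_fun y s"
    unfolding normX_fun_def
    using norm_triangle_ineq[of "x$1 * cis s + cnj (x$4)" "y$1 * cis s + cnj (y$4)"]
      norm_triangle_ineq[of "x$2 * cis s + cnj (x$3)" "y$2 * cis s + cnj (y$3)"]
    by (simp add: algebra_simps)
  then show ?thesis using s normX_fun_le_normX[of x s] normX_fun_le_normX[of y s] by linarith
qed

lemma normX_le_norm: "normX z \<le> 4 * norm z"
proof -
  obtain s where "normX z = normX_fun z s" using normX_is_max by blast
  then show ?thesis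
    using normX_fun_le[of z s] Finite_Cartesian_Product.norm_nth_le[of z 1] Finite_Cartesian_Product.norm_nth_le[of z 2]
      Finite_Cartesian_Product.norm_nth_le[of z 3] Finite_Cartesian_Product.norm_nth_le[of z 4] by linarith
qed

lemma normX_continuous: "continuous_on S normX"
proof -
  have "normX x - normX y \<le> 4 * dist x y" for x y
    using normX_triangle[of "x - y" y] normX_le_norm[of "x - y"] by (simp add: dist_norm)
  then have "\<bar>normX x - normX y\<bar> \<le> 4 * dist x y" for x y
    by (metis abs_le_iff dist_commute minus_diff_eq)
  then have "4-lipschitz_on S normX" by (intro lipschitz_onI) (auto simp: dist_real_def)
  then show ?thesis by (rule lipschitz_on_continuous_on)
qed

lemma cmod_rotate: "\<exists>s. cmod (a * cis s + cnj b) = cmod a + cmod b"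
proof -
  have "a * cis (- Arg b - Arg a) + cnj b = of_real (cmod a + cmod b) * cis (- Arg b)"
  proof -
    have "a = of_real (cmod a) * cis (Arg a)" "b = of_real (cmod b) * cis (Arg b)"
      by (metis rcis_cmod_Arg rcis_def)+
    then have "a * cis (- Arg b - Arg a) = of_real (cmod a) * cis (- Arg b)"
      "cnj b = of_real (cmod b) * cis (- Arg b)"
      by (metis (no_types, lifting) ab_semigroup_mult_class.mult_ac(1) add.commute cis_mult
            diff_add_cancel, metis cis_cnj complex_cnj_complex_of_real complex_cnj_mult)
    then show ?thesis by (simp add: algebra_simps)
  qed
  then show ?thesis
    by (metis abs_of_nonneg add_nonneg_nonneg mult.right_neutral norm_cis norm_ge_zero norm_mult
        norm_of_real)
qed

lemma cmod_nth_le_normX: "cmod (z $ i) \<le> normX z"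
proof -
  obtain s where s: "cmod (z$1 * cis s + cnj (z$4)) = cmod (z$1) + cmod (z$4)"
    using cmod_rotate by blast
  obtain t where t: "cmod (z$2 * cis t + cnj (z$3)) = cmod (z$2) + cmod (z$3)"
    using cmod_rotate by blast
  have "cmod (z$1) + cmod (z$4) \<le> normX z" "cmod (z$2) + cmod (z$3) \<le> normX z"
    using normX_fun_le_normX[of z s] normX_fun_le_normX[of z t] s t
    by (auto simp: normX_fun_def intro: order_trans[rotated])
  moreover have "i = 1 \<or> i = 2 \<or> i = 3 \<or> i = 4" by (rule exhaust_4)
  ultimately show ?thesis
    using norm_ge_zero[of "z$1"] norm_ge_zero[of "z$2"] norm_ge_zero[of "z$3"]
      norm_ge_zero[of "z$4"] by (smt (verit))
qed

lemma compact_normX_sphere: "compact {z. normX z = 1}"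
proof -
  have "closed {z. normX z = 1}"
    using continuous_closed_preimage_constant[OF normX_continuous[of UNIV], of 1] by simp
  moreover have "norm z \<le> 4" if "normX z = 1" for z
  proof -
    have "norm z \<le> (\<Sum>i\<in>UNIV. norm (z $ i))"
      unfolding norm_vec_def by (rule L2_set_le_sum) simp
    also have "\<dots> \<le> (\<Sum>i\<in>(UNIV::4 set). 1)"
      by (rule sum_mono) (use cmod_nth_le_normX that in metis)
    finally show ?thesis by simp
  qed
  ultimately show ?thesis by (auto simp: compact_eq_bounded_closed bounded_iff)
qed

lemma normX_axis: "normX (axis 1 1) = 1"
  by (simp add: normX_def normX_fun_def axis_def)

lemma dual_normX_is_max:
  "\<exists>z. normX z = 1 \<and> dual_normX c = cmod (pairing c z)
       \<and> (\<forall>w. normX w = 1 \<longrightarrow> cmod (pairing c w) \<le> cmod (pairing c z))"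
proof -
  have "continuous_on {z. normX z = 1} (\<lambda>z. cmod (pairing c z))"
    unfolding pairing_def by (intro continuous_intros)
  moreover have "{z. normX z = 1} \<noteq> {}" using normX_axis by auto
  ultimately obtain z where z: "normX z = 1"
    "\<forall>w. normX w = 1 \<longrightarrow> cmod (pairing c w) \<le> cmod (pairing c z)"
    using continuous_attains_sup[OF compact_normX_sphere] by blast
  then have "dual_normX c = cmod (pairing c z)"
    unfolding dual_normX_def by (intro cSup_eq_maximum) auto
  with z show ?thesis by blast
qed

end

theory Submission
  imports Defs
begin

text \<open>
  The functionals of dual norm \<open>1\<close> that cut out the unit ball are those with unimodular
  coefficients \<open>p, q, r, s\<close> satisfying \<open>p s = q r\<close>. If \<open>v\<^sub>k \<le> 0\<close>, then \<open>\<bar>c\<^sub>k\<bar>\<close> is the strict maximum;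
  dividing by \<open>c\<^sub>k\<close> gives \<open>(1, \<beta>, \<gamma>, \<delta>)\<close>, and \<open>v\<^sub>k \<le> 0\<close> says that the correlation matrix
  with off-diagonal entries \<open>\<beta>, \<gamma>, \<delta>\<close> is positive semidefinite whatever their phases. An extreme complex
  \<open>3 \<times> 3\<close> correlation matrix has rank one, so \<open>(1, \<beta>, \<gamma>, \<delta>)\<close> is a convex combination of vectors
  \<open>(1, q, r, q r)\<close> with \<open>\<bar>q\<bar> = \<bar>r\<bar> = 1\<close>. Two such vectors suffice when \<open>\<bar>\<delta> - \<beta> \<gamma>\<bar>\<close> has its largest possible
  value, and by convexity only this case matters.
\<close>

section \<open>Turning complex numbers by unimodular factors\<close>

lemma ex_unit_mult_eq_cmod: "\<exists>w. cmod w = 1 \<and> w * \<zeta> = of_real (cmod \<zeta>)"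
proof (cases "\<zeta> = 0")
  case True
  then show ?thesis by (intro exI[of _ 1]) simp
next
  case False
  then have "cnj (sgn \<zeta>) * \<zeta> = of_real (cmod \<zeta>)"
    using complex_norm_square[of \<zeta>] by (simp add: sgn_eq power2_eq_square field_simps)
  then show ?thesis
    using False by (intro exI[of _ "cnj (sgn \<zeta>)"]) (simp add: norm_sgn)
qed

lemma ex_unit_Re_mult_eq_0: "\<exists>w. cmod w = 1 \<and> Re (\<zeta> * w) = 0"
proof -
  obtain w where w: "cmod w = 1" "w * \<zeta> = of_real (cmod \<zeta>)"
    using ex_unit_mult_eq_cmod by blast
  then have "\<zeta> * (\<i> * w) = \<i> * of_real (cmod \<zeta>)"
    by (metis mult.commute mult.left_commute)
  then have "Re (\<zeta> * (\<i> * w)) = Re (\<i> * of_real (cmod \<zeta>))"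
    by (rule arg_cong)
  then have "Re (\<zeta> * (\<i> * w)) = 0"
    by (simp only: Re_i_times Im_complex_of_real minus_zero)
  then show ?thesis
    using w(1) by (intro exI[of _ "\<i> * w"]) (simp add: norm_mult del: times_complex.sel)
qed

lemma ex_unit_cmod_add_mult_eq: "\<exists>w. cmod w = 1 \<and> cmod (a + w * b) = cmod a + cmod b"
proof -
  obtain u v where u: "cmod u = 1" "u * a = of_real (cmod a)"
    and v: "cmod v = 1" "v * b = of_real (cmod b)"
    using ex_unit_mult_eq_cmod by metis
  have "cmod (a + v / u * b) = cmod (u * (a + v / u * b))"
    using u(1) by (simp add: norm_mult)
  also have "u * (a + v / u * b) = of_real (cmod a + cmod b)"
  proof -
    have "u \<noteq> 0" using u(1) by auto
    then show ?thesis using u(2) v(2) by (simp add: distrib_left)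
  qed
  also have "cmod \<dots> = cmod a + cmod b"
    by (simp only: norm_of_real) simp
  finally show ?thesis
    using u(1) v(1) by (intro exI[of _ "v / u"]) (simp add: norm_divide)
qed

section \<open>Unimodular functionals bounded by the norm\<close>

text \<open>Conjugating \<open>s * z$4\<close> and \<open>r * z$3\<close> keeps real parts. Pulling
  out the unit factors \<open>cnj s\<close> and \<open>cnj r\<close> then leaves \<open>z$1\<close>
  and \<open>z$2\<close> with the factors \<open>p * s\<close> and \<open>q * r\<close>; these agree
  and equal some \<open>cis \<sigma>\<close>, which gives
  \<open>normX_fun z \<sigma>\<close>.\<close>

lemma cmod_unimodular_combination_le_normX:
  assumes "cmod p = 1" "cmod q = 1" "cmod r = 1" "cmod s = 1" "p * s = q * r"
  shows "cmod (p * z$1 + q * z$2 + r * z$3 + s * z$4) \<le> normX z"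
proof -
  have factor: "cmod (a * x + cnj (b * y)) = cmod (x * (a * b) + cnj y)" if "cmod b = 1" for a b x y
  proof -
    have "b * cnj b = 1" using that by (simp flip: complex_norm_square)
    then have "b * (a * x + cnj (b * y)) = x * (a * b) + cnj y"
      by (simp add: algebra_simps)
    then show ?thesis using that by (metis mult_1 norm_mult)
  qed
  have Re_le: "Re (p * z$1 + q * z$2 + r * z$3 + s * z$4) \<le> normX z"
    if unit: "cmod p = 1" "cmod q = 1" "cmod r = 1" "cmod s = 1" and eq: "p * s = q * r" for p q r s
  proof -
    have "cmod (p * s) = 1" using unit by (simp add: norm_mult)
    then obtain \<sigma> where \<sigma>: "p * s = cis \<sigma>"
      by (metis complex_norm_eq_1_exp cis_conv_exp)
    have "Re (p * z$1 + q * z$2 + r * z$3 + s * z$4)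
        = Re (p * z$1 + cnj (s * z$4)) + Re (q * z$2 + cnj (r * z$3))"
      by simp
    also have "\<dots> \<le> cmod (p * z$1 + cnj (s * z$4)) + cmod (q * z$2 + cnj (r * z$3))"
      by (intro add_mono complex_Re_le_cmod)
    also have "\<dots> = normX_fun z \<sigma>"
      unfolding factor[OF unit(4)] factor[OF unit(3)] normX_fun_def using eq \<sigma> by metis
    also have "\<dots> \<le> normX z" by (rule normX_fun_le_normX)
    finally show ?thesis .
  qed
  \<comment> \<open>A common unit factor \<open>w\<close> multiplies both sides of
    \<open>p * s = q * r\<close> by the square of \<open>w\<close>, so the bound on real parts
    yields the bound on the modulus.\<close>
  obtain w where w: "cmod w = 1"
    "w * (p * z$1 + q * z$2 + r * z$3 + s * z$4)
      = of_real (cmod (p * z$1 + q * z$2 + r * z$3 + s * z$4))"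
    using ex_unit_mult_eq_cmod by blast
  have "cmod (p * z$1 + q * z$2 + r * z$3 + s * z$4)
      = Re (w * (p * z$1 + q * z$2 + r * z$3 + s * z$4))"
    by (simp only: w(2) Re_complex_of_real)
  also have "\<dots> = Re (w * p * z$1 + w * q * z$2 + w * r * z$3 + w * s * z$4)"
    by (simp only: distrib_left mult.assoc)
  also have "\<dots> \<le> normX z"
    using assms w(1) by (intro Re_le) (simp_all add: norm_mult)
  finally show ?thesis .
qed

section \<open>Two-point decompositions with maximal covariance\<close>

text \<open>
  The line through \<open>\<beta>\<close> in direction \<open>\<omega>\<close> meets the unit circle in the points \<open>\<beta> + k \<omega> s\<close> and
  \<open>\<beta> - \<omega> s / k\<close>, which have the weights \<open>1 / (1 + k\<^sup>2)\<close> and \<open>k\<^sup>2 / (1 + k\<^sup>2)\<close> in \<open>\<beta>\<close>.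
\<close>

lemma cmod_chord_endpoints:
  fixes k s \<kappa> :: real
  assumes \<omega>: "cmod \<omega> = 1" and s: "s\<^sup>2 = 1 - (cmod \<beta>)\<^sup>2"
    and \<kappa>: "Re (cnj \<beta> * \<omega>) = \<kappa> * s" and k: "k > 0" "k\<^sup>2 + 2 * \<kappa> * k = 1"
  shows "cmod (\<beta> + of_real (k * s) * \<omega>) = 1" "cmod (\<beta> - of_real (s / k) * \<omega>) = 1"
proof -
  have expand: "(cmod (\<beta> + of_real x * \<omega>))\<^sup>2 = (cmod \<beta>)\<^sup>2 + 2 * x * Re (cnj \<beta> * \<omega>) + x\<^sup>2" for x
  proof -
    have "(Re \<omega>)\<^sup>2 + (Im \<omega>)\<^sup>2 = 1"
      using \<omega> by (metis cmod_power2 one_power2)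
    then have "x\<^sup>2 = x\<^sup>2 * ((Re \<omega>)\<^sup>2 + (Im \<omega>)\<^sup>2)" by simp
    then show ?thesis
      unfolding cmod_power2 by (simp add: power2_eq_square algebra_simps)
  qed
  have "(cmod (\<beta> + of_real (k * s) * \<omega>))\<^sup>2 = (cmod \<beta>)\<^sup>2 + s\<^sup>2 * (k\<^sup>2 + 2 * \<kappa> * k)"
    unfolding expand \<kappa> by (simp add: power2_eq_square algebra_simps)
  then have "(cmod (\<beta> + of_real (k * s) * \<omega>))\<^sup>2 = 1"
    using s k(2) by simp
  then show "cmod (\<beta> + of_real (k * s) * \<omega>) = 1"
    by (simp add: power2_eq_1_iff) (smt (verit) norm_ge_zero)
  \<comment> \<open>The roots of \<open>x * x + 2 * \<kappa> * x = 1\<close> have product -1, so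
    -1/k is the other one and gives the second endpoint.\<close>
  have "1 - 2 * \<kappa> * k = k\<^sup>2"
    using k(2) by simp
  then have ratio: "(1 - 2 * \<kappa> * k) / k\<^sup>2 = 1"
    using k(1) by simp
  have "(cmod \<beta>)\<^sup>2 + 2 * (- (s / k)) * (\<kappa> * s) + (- (s / k))\<^sup>2 = 1"
  proof -
    have "2 * (- (s / k)) * (\<kappa> * s) + (- (s / k))\<^sup>2 = s\<^sup>2 * ((1 - 2 * \<kappa> * k) / k\<^sup>2)"
      using k(1) unfolding power2_eq_square diff_divide_distrib right_diff_distrib by simp
    also have "\<dots> = s\<^sup>2" by (simp only: ratio mult_1_right)
    finally show ?thesis using s by linarith
  qed
  then have "(cmod (\<beta> + of_real (- (s / k)) * \<omega>))\<^sup>2 = 1"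
    unfolding expand \<kappa> .
  then have "cmod (\<beta> + of_real (- (s / k)) * \<omega>) = 1"
    by (simp add: power2_eq_1_iff) (smt (verit) norm_ge_zero)
  then show "cmod (\<beta> - of_real (s / k) * \<omega>) = 1"
    by simp
qed

text \<open>Chords through \<beta> and \<gamma> whose directions have product \<open>u\<close> can
  be chosen so that both are cut in the same ratio. Their endpoints then pair up with common
  weights: the means are \<beta> and \<gamma>, and the covariance has the largest modulus that
  Cauchy-Schwarz allows, with the prescribed phase \<open>u\<close>.\<close>

lemma unit_pair_decomposition:
  assumes \<beta>: "cmod \<beta> < 1" and \<gamma>: "cmod \<gamma> < 1" and u: "cmod u = 1"
  obtains m q r q' r' where "0 \<le> m" "m \<le> 1"
    "cmod q = 1" "cmod r = 1" "cmod q' = 1" "cmod r' = 1"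
    "\<beta> = of_real m * q + of_real (1 - m) * q'"
    "\<gamma> = of_real m * r + of_real (1 - m) * r'"
    "\<beta> * \<gamma> + of_real (sqrt (1 - (cmod \<beta>)\<^sup>2) * sqrt (1 - (cmod \<gamma>)\<^sup>2)) * u
      = of_real m * (q * r) + of_real (1 - m) * (q' * r')"
proof -
  define s t where "s = sqrt (1 - (cmod \<beta>)\<^sup>2)" and "t = sqrt (1 - (cmod \<gamma>)\<^sup>2)"
  have s: "s\<^sup>2 = 1 - (cmod \<beta>)\<^sup>2" "s > 0" and t: "t\<^sup>2 = 1 - (cmod \<gamma>)\<^sup>2" "t > 0"
    using \<beta> \<gamma> by (simp_all add: s_def t_def abs_square_less_1 less_imp_le)
  \<comment> \<open>For \<open>\<omega>' = u * cnj \<omega>\<close> this condition says that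
    \<open>Re (cnj \<beta> * \<omega>) / s\<close> equals
    \<open>Re (cnj \<gamma> * \<omega>') / t\<close>. Hence one \<kappa>, one \<open>k\<close> and
    one weight serve both chords.\<close>
  obtain \<omega> where \<omega>: "cmod \<omega> = 1" "Re ((of_real t * cnj \<beta> - of_real s * (\<gamma> * cnj u)) * \<omega>) = 0"
    using ex_unit_Re_mult_eq_0 by blast
  define \<omega>' where "\<omega>' = u * cnj \<omega>"
  define \<kappa> where "\<kappa> = Re (cnj \<beta> * \<omega>) / s"
  define k where "k = sqrt (\<kappa>\<^sup>2 + 1) - \<kappa>"
  have \<kappa>: "Re (cnj \<beta> * \<omega>) = \<kappa> * s"
    using s(2) by (simp add: \<kappa>_def)
  have "Re (cnj \<gamma> * \<omega>') = Re (\<gamma> * cnj u * \<omega>)"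
    unfolding \<omega>'_def by (simp add: algebra_simps)
  moreover have "t * Re (cnj \<beta> * \<omega>) = s * Re (\<gamma> * cnj u * \<omega>)"
    using \<omega>(2) by (simp add: algebra_simps)
  ultimately have "s * Re (cnj \<gamma> * \<omega>') = s * (\<kappa> * t)"
    unfolding \<kappa> by (simp only: mult_ac)
  then have \<kappa>': "Re (cnj \<gamma> * \<omega>') = \<kappa> * t"
    using s(2) by (simp only: mult_cancel_left) simp
  have \<omega>': "cmod \<omega>' = 1" using u \<omega>(1) by (simp add: \<omega>'_def norm_mult)
  have \<omega>\<omega>': "\<omega> * \<omega>' = u"
    using \<omega>(1) complex_norm_square[of \<omega>] by (simp add: \<omega>'_def mult.left_commute)
  have k: "k > 0" "k\<^sup>2 + 2 * \<kappa> * k = 1"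
  proof -
    have "\<kappa> < sqrt (\<kappa>\<^sup>2 + 1)" by (rule real_less_rsqrt) simp
    then show "k > 0" by (simp add: k_def)
    have "(sqrt (\<kappa>\<^sup>2 + 1))\<^sup>2 = \<kappa>\<^sup>2 + 1" by simp
    then show "k\<^sup>2 + 2 * \<kappa> * k = 1"
      by (simp add: k_def power2_eq_square algebra_simps)
  qed
  \<comment> \<open>With weights \<open>m\<close> and \<open>1 - m\<close> the deviations
    \<open>k\<close> and -1/k have mean 0 and mean square 1. The first removes the mixed terms in
    \<open>cov\<close>, the second leaves exactly \<open>y * y'\<close>.\<close>
  define m where "m = 1 / (1 + k\<^sup>2)"
  have "1 + k\<^sup>2 > 0" by (simp add: add_pos_nonneg)
  then have m: "0 \<le> m" "m \<le> 1" by (simp_all add: m_def)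
  have "(1 + k\<^sup>2) \<noteq> 0" using \<open>1 + k\<^sup>2 > 0\<close> by simp
  then have "1 - m = k\<^sup>2 / (1 + k\<^sup>2)" by (simp add: m_def field_simps)
  then have weights: "m * k = (1 - m) / k" "m * (k * k) + (1 - m) / (k * k) = 1"
    using k(1) \<open>(1 + k\<^sup>2) \<noteq> 0\<close>
    by (simp_all add: m_def power2_eq_square add_divide_distrib[symmetric])
  define M K L where "M = complex_of_real m" and "K = complex_of_real k" and "L = 1 / K"
  have M: "M * K = (1 - M) * L" "M * (K * K) + (1 - M) * (L * L) = 1"
    using weights[THEN arg_cong[where f = complex_of_real]]
    by (simp_all add: M_def K_def L_def)
  have mean: "x = M * (x + K * y) + (1 - M) * (x - L * y)" for x y
  proof -
    have "M * (x + K * y) + (1 - M) * (x - L * y) = x + (M * K - (1 - M) * L) * y"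
      by (simp add: algebra_simps)
    then show ?thesis using M(1) by simp
  qed
  have cov: "x * x' + y * y' = M * ((x + K * y) * (x' + K * y')) + (1 - M) * ((x - L * y) * (x' - L * y'))"
    for x x' y y'
  proof -
    have "M * ((x + K * y) * (x' + K * y')) + (1 - M) * ((x - L * y) * (x' - L * y'))
       = x * x' + (M * K - (1 - M) * L) * (x * y' + y * x') + (M * (K * K) + (1 - M) * (L * L)) * (y * y')"
      by (simp add: algebra_simps)
    then show ?thesis using M by simp
  qed
  show thesis
  proof (rule that[OF m])
    show "cmod (\<beta> + of_real (k * s) * \<omega>) = 1" "cmod (\<gamma> + of_real (k * t) * \<omega>') = 1"
      "cmod (\<beta> - of_real (s / k) * \<omega>) = 1" "cmod (\<gamma> - of_real (t / k) * \<omega>') = 1"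
      by (fact cmod_chord_endpoints[OF \<omega>(1) s(1) \<kappa> k] cmod_chord_endpoints[OF \<omega>' t(1) \<kappa>' k])+
    show "\<beta> = of_real m * (\<beta> + of_real (k * s) * \<omega>) + of_real (1 - m) * (\<beta> - of_real (s / k) * \<omega>)"
      using mean[of \<beta> "of_real s * \<omega>"] by (simp add: M_def K_def L_def mult.assoc)
    show "\<gamma> = of_real m * (\<gamma> + of_real (k * t) * \<omega>') + of_real (1 - m) * (\<gamma> - of_real (t / k) * \<omega>')"
      using mean[of \<gamma> "of_real t * \<omega>'"] by (simp add: M_def K_def L_def mult.assoc)
    have st: "of_real s * (of_real t * u) = of_real s * (\<omega> * (of_real t * \<omega>'))"
      by (simp add: mult.left_commute flip: \<omega>\<omega>')
    show "\<beta> * \<gamma> + of_real (sqrt (1 - (cmod \<beta>)\<^sup>2) * sqrt (1 - (cmod \<gamma>)\<^sup>2)) * u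
      = of_real m * ((\<beta> + of_real (k * s) * \<omega>) * (\<gamma> + of_real (k * t) * \<omega>'))
        + of_real (1 - m) * ((\<beta> - of_real (s / k) * \<omega>) * (\<gamma> - of_real (t / k) * \<omega>'))"
      using cov[of \<beta> \<gamma> "of_real s * \<omega>" "of_real t * \<omega>'"]
      by (simp add: st M_def K_def L_def mult.assoc flip: s_def t_def)
  qed
qed

section \<open>From unimodular coefficients to a dominant coefficient\<close>

lemma cmod_correlation_combination_le:
  fixes A B C D :: complex
  assumes bound: "\<And>q r. cmod q = 1 \<Longrightarrow> cmod r = 1 \<Longrightarrow> cmod (A + q * B + r * C + q * r * D) \<le> N"
    and \<beta>: "cmod \<beta> < 1" and \<gamma>: "cmod \<gamma> < 1"
    and psd: "(cmod \<beta>)\<^sup>2 + (cmod \<gamma>)\<^sup>2 + (cmod \<delta>)\<^sup>2 + 2 * cmod \<beta> * cmod \<gamma> * cmod \<delta> \<le> 1"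
  shows "cmod (A + \<beta> * B + \<gamma> * C + \<delta> * D) \<le> N"
proof -
  define \<rho> where "\<rho> = sqrt (1 - (cmod \<beta>)\<^sup>2) * sqrt (1 - (cmod \<gamma>)\<^sup>2)"
  have \<rho>: "\<rho> = sqrt ((1 - (cmod \<beta>)\<^sup>2) * (1 - (cmod \<gamma>)\<^sup>2))" "\<rho> \<ge> 0"
    using \<beta> \<gamma> by (simp_all add: \<rho>_def real_sqrt_mult abs_square_le_1 less_imp_le)
  have "cmod (\<delta> - \<beta> * \<gamma>) \<le> cmod \<delta> + cmod \<beta> * cmod \<gamma>"
    using norm_triangle_ineq4[of \<delta> "\<beta> * \<gamma>"] by (simp add: norm_mult)
  \<comment> \<open>Squared and expanded, this is exactly \<open>psd\<close>.\<close>
  also have "\<dots> \<le> \<rho>"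
    unfolding \<rho>(1) by (rule real_le_rsqrt) (use psd in \<open>simp add: power2_eq_square algebra_simps\<close>)
  finally have \<delta>: "cmod (\<delta> - \<beta> * \<gamma>) \<le> \<rho>" .
  define E where "E = A + \<beta> * B + \<gamma> * C + \<beta> * \<gamma> * D"
  \<comment> \<open>As \<delta> runs through the disc of radius \<rho> about
    \<open>\<beta> * \<gamma>\<close>, the modulus is largest at
    \<open>\<beta> * \<gamma> + \<rho> * u\<close>, which the two-point decomposition
    reaches.\<close>
  obtain u where u: "cmod u = 1" "cmod (E + u * (of_real \<rho> * D)) = cmod E + cmod (of_real \<rho> * D)"
    using ex_unit_cmod_add_mult_eq by blast
  obtain m q r q' r' where m: "0 \<le> m" "m \<le> 1"
    and unit: "cmod q = 1" "cmod r = 1" "cmod q' = 1" "cmod r' = 1"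
    and eqs: "\<beta> = of_real m * q + of_real (1 - m) * q'"
      "\<gamma> = of_real m * r + of_real (1 - m) * r'"
      "\<beta> * \<gamma> + of_real \<rho> * u = of_real m * (q * r) + of_real (1 - m) * (q' * r')"
    using unit_pair_decomposition[OF \<beta> \<gamma> u(1)] unfolding \<rho>_def by metis
  have "cmod (A + \<beta> * B + \<gamma> * C + \<delta> * D) = cmod (E + (\<delta> - \<beta> * \<gamma>) * D)"
    by (simp add: E_def algebra_simps)
  also have "\<dots> \<le> cmod E + cmod (\<delta> - \<beta> * \<gamma>) * cmod D"
    using norm_triangle_ineq[of E "(\<delta> - \<beta> * \<gamma>) * D"] by (simp add: norm_mult)
  also have "\<dots> \<le> cmod E + \<rho> * cmod D"
    using \<delta> by (simp add: mult_right_mono)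
  also have "\<dots> = cmod (E + u * (of_real \<rho> * D))"
    using \<rho>(2) by (simp add: u(2) norm_mult)
  also have "E + u * (of_real \<rho> * D)
      = A + \<beta> * B + \<gamma> * C + (\<beta> * \<gamma> + of_real \<rho> * u) * D"
    by (simp add: E_def algebra_simps)
  also have "\<dots> = of_real m * (A + q * B + r * C + q * r * D)
      + of_real (1 - m) * (A + q' * B + r' * C + q' * r' * D)"
    unfolding eqs(3) by (subst eqs(1), subst eqs(2)) (simp add: algebra_simps)
  also have "cmod \<dots> \<le> m * cmod (A + q * B + r * C + q * r * D)
      + (1 - m) * cmod (A + q' * B + r' * C + q' * r' * D)"
    by (rule order_trans[OF norm_triangle_ineq])
      (use m in \<open>simp only: norm_mult norm_of_real abs_of_nonneg diff_ge_0_iff_ge order.refl\<close>)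
  also have "\<dots> \<le> m * N + (1 - m) * N"
    using m unit by (intro add_mono mult_left_mono bound) simp_all
  also have "\<dots> = N" by (simp add: algebra_simps)
  finally show ?thesis .
qed

lemma cmod_linear_combination_le:
  assumes bound: "\<And>q r. cmod q = 1 \<Longrightarrow> cmod r = 1 \<Longrightarrow> cmod (A + q * B + r * C + q * r * D) \<le> N"
    and nonzero: "a \<noteq> 0" "b \<noteq> 0" "c \<noteq> 0" "d \<noteq> 0"
    and v: "cmod a * (- (cmod a)\<^sup>2 + (cmod b)\<^sup>2 + (cmod c)\<^sup>2 + (cmod d)\<^sup>2)
      + 2 * cmod b * cmod c * cmod d \<le> 0"
  shows "cmod (a * A + b * B + c * C + d * D) \<le> cmod a * N"
proof -
  have pos: "cmod a > 0" "cmod b > 0" "cmod c > 0" "cmod d > 0" using nonzero by simp_all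
  have "0 < cmod b * cmod c * cmod d" using pos by simp
  then have "cmod a * (- (cmod a)\<^sup>2 + (cmod b)\<^sup>2 + (cmod c)\<^sup>2 + (cmod d)\<^sup>2) < 0"
    using v by linarith
  then have sq: "(cmod b)\<^sup>2 + (cmod c)\<^sup>2 + (cmod d)\<^sup>2 < (cmod a)\<^sup>2"
    using pos(1) by (simp add: mult_less_0_iff)
  then have "(cmod b)\<^sup>2 < (cmod a)\<^sup>2" "(cmod c)\<^sup>2 < (cmod a)\<^sup>2"
    by (smt (verit) zero_le_power2)+
  then have lt: "cmod b < cmod a" "cmod c < cmod a"
    by (auto intro: power2_less_imp_less)
  have "cmod (A + b / a * B + c / a * C + d / a * D) \<le> N"
  proof (rule cmod_correlation_combination_le[OF bound])
    show "cmod (b / a) < 1" "cmod (c / a) < 1"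
      using lt pos(1) by (simp_all add: norm_divide)
    \<comment> \<open>Dividing \<open>v\<close> by the cube of \<open>cmod a\<close> turns it into
      the correlation condition for the quotients.\<close>
    have "(cmod (b / a))\<^sup>2 + (cmod (c / a))\<^sup>2 + (cmod (d / a))\<^sup>2
        + 2 * cmod (b / a) * cmod (c / a) * cmod (d / a) - 1
      = (cmod a * (- (cmod a)\<^sup>2 + (cmod b)\<^sup>2 + (cmod c)\<^sup>2 + (cmod d)\<^sup>2)
      + 2 * cmod b * cmod c * cmod d) / (cmod a) ^ 3"
      using pos(1) by (simp add: norm_divide power2_eq_square power3_eq_cube field_simps)
    also have "\<dots> \<le> 0" using v pos(1) by (simp add: divide_nonpos_pos)
    finally show "(cmod (b / a))\<^sup>2 + (cmod (c / a))\<^sup>2 + (cmod (d / a))\<^sup>2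
        + 2 * cmod (b / a) * cmod (c / a) * cmod (d / a) \<le> 1" by simp
  qed
  then have "cmod a * cmod (A + b / a * B + c / a * C + d / a * D) \<le> cmod a * N"
    by (simp add: mult_left_mono)
  moreover have "a * (A + b / a * B + c / a * C + d / a * D) = a * A + b * B + c * C + d * D"
    using nonzero(1) by (simp add: distrib_left)
  ultimately show ?thesis by (metis norm_mult)
qed

section \<open>The numbers \<open>vX\<close> and bounds for the dual norm\<close>

lemma UNIV_4_diff:
  "UNIV - {1::4} = {2, 3, 4}" "UNIV - {2::4} = {1, 3, 4}"
  "UNIV - {3::4} = {1, 2, 4}" "UNIV - {4::4} = {1, 2, 3}"
  using exhaust_4 by auto

text \<open>The summands are ordered to match the hypothesis \<open>v\<close> of
  \<open>cmod_linear_combination_le\<close>: the partner of \<open>k\<close> in the pairs {1,4} and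
  {2,3} comes last.\<close>

lemma vX_simps:
  "vX c 1 = cmod (c$1) * (- (cmod (c$1))\<^sup>2 + (cmod (c$2))\<^sup>2 + (cmod (c$3))\<^sup>2 + (cmod (c$4))\<^sup>2)
    + 2 * cmod (c$2) * cmod (c$3) * cmod (c$4)"
  "vX c 2 = cmod (c$2) * (- (cmod (c$2))\<^sup>2 + (cmod (c$1))\<^sup>2 + (cmod (c$4))\<^sup>2 + (cmod (c$3))\<^sup>2)
    + 2 * cmod (c$1) * cmod (c$4) * cmod (c$3)"
  "vX c 3 = cmod (c$3) * (- (cmod (c$3))\<^sup>2 + (cmod (c$1))\<^sup>2 + (cmod (c$4))\<^sup>2 + (cmod (c$2))\<^sup>2)
    + 2 * cmod (c$1) * cmod (c$4) * cmod (c$2)"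
  "vX c 4 = cmod (c$4) * (- (cmod (c$4))\<^sup>2 + (cmod (c$2))\<^sup>2 + (cmod (c$3))\<^sup>2 + (cmod (c$1))\<^sup>2)
    + 2 * cmod (c$2) * cmod (c$3) * cmod (c$1)"
  by (simp_all add: vX_def UNIV_4_diff sum_4 algebra_simps)

text \<open>The positive product forces a negative bracket, so the square of
  \<open>cmod (c $ k)\<close> exceeds the sum of the other three squares.\<close>

lemma cmod_lt_of_vX_nonpos:
  assumes "\<forall>k. cmod (c $ k) > 0" and "vX c k \<le> 0" and "j \<noteq> k"
  shows "cmod (c $ j) < cmod (c $ k)"
proof -
  have "(\<Prod>i\<in>UNIV - {k}. cmod (c $ i)) > 0"
    using assms(1) by (intro prod_pos) simp
  then have "cmod (c $ k) * (- 2 * (cmod (c $ k))\<^sup>2 + (\<Sum>i\<in>UNIV. (cmod (c $ i))\<^sup>2)) < 0"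
    using assms(2) unfolding vX_def by linarith
  then have "(\<Sum>i\<in>UNIV. (cmod (c $ i))\<^sup>2) < 2 * (cmod (c $ k))\<^sup>2"
    by (simp add: mult_less_0_iff)
  moreover have "(\<Sum>i\<in>{j, k}. (cmod (c $ i))\<^sup>2) \<le> (\<Sum>i\<in>UNIV. (cmod (c $ i))\<^sup>2)"
    by (rule sum_mono2) auto
  ultimately have "(cmod (c $ j))\<^sup>2 < (cmod (c $ k))\<^sup>2"
    using assms(3) by simp
  then show ?thesis by (auto intro: power2_less_imp_less)
qed

text \<open>With coefficient 1 at \<open>k\<close>, the constraint \<open>p * s = q * r\<close>
  makes the coefficient at the partner of \<open>k\<close> the product of the other two. Each case
  is thus the same estimate with permuted coordinates.\<close>

lemma cmod_pairing_le:
  assumes nz: "\<forall>k. cmod (c $ k) > 0" and v: "vX c k \<le> 0"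
  shows "cmod (pairing c z) \<le> cmod (c $ k) * normX z"
proof -
  have nz: "c $ j \<noteq> 0" for j using nz by auto
  note unimodular = cmod_unimodular_combination_le_normX[of _ _ _ _ z]
  consider "k = 1" | "k = 2" | "k = 3" | "k = 4" using exhaust_4 by blast
  then show ?thesis
  proof cases
    case 1
    have "cmod (c$1 * z$1 + c$2 * z$2 + c$3 * z$3 + c$4 * z$4) \<le> cmod (c$1) * normX z"
    proof (rule cmod_linear_combination_le)
      show "cmod (z$1 + q * z$2 + r * z$3 + q * r * z$4) \<le> normX z" if "cmod q = 1" "cmod r = 1" for q r
        using unimodular[of 1 q r "q * r"] that by (simp add: norm_mult add_ac)
    qed (use nz v 1 in \<open>simp_all add: vX_simps\<close>)
    then show ?thesis
      by (simp add: 1 pairing_def sum_4 add_ac)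
  next
    case 2
    have "cmod (c$2 * z$2 + c$1 * z$1 + c$4 * z$4 + c$3 * z$3) \<le> cmod (c$2) * normX z"
    proof (rule cmod_linear_combination_le)
      show "cmod (z$2 + q * z$1 + r * z$4 + q * r * z$3) \<le> normX z" if "cmod q = 1" "cmod r = 1" for q r
        using unimodular[of q 1 "q * r" r] that by (simp add: norm_mult add_ac)
    qed (use nz v 2 in \<open>simp_all add: vX_simps\<close>)
    then show ?thesis
      by (simp add: 2 pairing_def sum_4 add_ac)
  next
    case 3
    have "cmod (c$3 * z$3 + c$1 * z$1 + c$4 * z$4 + c$2 * z$2) \<le> cmod (c$3) * normX z"
    proof (rule cmod_linear_combination_le)
      show "cmod (z$3 + q * z$1 + r * z$4 + q * r * z$2) \<le> normX z" if "cmod q = 1" "cmod r = 1" for q r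
        using unimodular[of q "q * r" 1 r] that by (simp add: norm_mult add_ac)
    qed (use nz v 3 in \<open>simp_all add: vX_simps\<close>)
    then show ?thesis
      by (simp add: 3 pairing_def sum_4 add_ac)
  next
    case 4
    have "cmod (c$4 * z$4 + c$2 * z$2 + c$3 * z$3 + c$1 * z$1) \<le> cmod (c$4) * normX z"
    proof (rule cmod_linear_combination_le)
      show "cmod (z$4 + q * z$2 + r * z$3 + q * r * z$1) \<le> normX z" if "cmod q = 1" "cmod r = 1" for q r
        using unimodular[of "q * r" q r 1] that by (simp add: norm_mult add_ac)
    qed (use nz v 4 in \<open>simp_all add: vX_simps\<close>)
    then show ?thesis
      by (simp add: 4 pairing_def sum_4 add_ac)
  qed
qed

lemma cmod_nth_le_dual_normX: "cmod (c $ k) \<le> dual_normX c"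
proof -
  have "normX (axis k 1) = 1"
    using exhaust_4[of k] by (auto simp: normX_def normX_fun_def axis_def)
  moreover have "pairing c (axis k 1) = c $ k"
    by (simp add: pairing_def axis_def if_distrib cong: if_cong)
  ultimately show ?thesis
    using dual_normX_is_max[of c] by metis
qed

text \<open>Squaring \<open>b + x + y \<le> a\<close> and dropping the products \<open>b * x\<close>
  and \<open>b * y\<close> bounds the bracket by \<open>- 2 * (x * y)\<close>; then
  \<open>b \<le> a\<close> finishes.\<close>

lemma quadrangle_deficit_nonpos:
  fixes a b x y :: real
  assumes "a > 0" "b > 0" "x > 0" "y > 0" "b + x + y \<le> a"
  shows "a * (- a\<^sup>2 + b\<^sup>2 + x\<^sup>2 + y\<^sup>2) + 2 * b * x * y \<le> 0"
proof -
  have "(b + x + y)\<^sup>2 \<le> a\<^sup>2" using assms by (intro power_mono) auto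
  then have "- a\<^sup>2 + b\<^sup>2 + x\<^sup>2 + y\<^sup>2 \<le> - 2 * (x * y)"
    using mult_pos_pos[of b x] mult_pos_pos[of b y] assms(2-4)
    unfolding power2_eq_square distrib_left distrib_right mult.commute[of x b] mult.commute[of y b]
      mult.commute[of y x] by linarith
  then have "a * (- a\<^sup>2 + b\<^sup>2 + x\<^sup>2 + y\<^sup>2) \<le> a * (- 2 * (x * y))"
    using assms by (intro mult_left_mono) auto
  moreover have "b * (x * y) \<le> a * (x * y)"
    using assms by (intro mult_right_mono) auto
  ultimately show ?thesis by (simp add: mult.assoc)
qed

theorem theorem4p8:
  fixes c :: "complex ^ 4"
  assumes "\<forall>k. cmod (c $ k) > 0"
  shows "((\<forall>k. vX c k > 0) \<or> (\<exists>!k. vX c k \<le> 0))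
    \<and> ((\<exists>k. vX c k \<le> 0) \<longrightarrow> dual_normX c = norm_inf c)
    \<and> (\<not> make_quadrangle (\<chi> k. cmod (c $ k)) \<longrightarrow> (\<exists>k. vX c k \<le> 0))"
proof (intro conjI impI)
  \<comment> \<open>Two distinct indices with non-positive values would each have the strictly
    larger modulus.\<close>
  show "(\<forall>k. vX c k > 0) \<or> (\<exists>!k. vX c k \<le> 0)"
    using cmod_lt_of_vX_nonpos[OF assms] by (metis not_le order.asym)
next
  assume "\<exists>k. vX c k \<le> 0"
  then obtain k where k: "vX c k \<le> 0" by blast
  have "norm_inf c = cmod (c $ k)"
    unfolding norm_inf_def
    using cmod_lt_of_vX_nonpos[OF assms k] by (intro Max_eqI) (auto, metis order.refl less_imp_le)
  moreover have "dual_normX c = cmod (c $ k)"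
  proof (rule antisym)
    obtain z where "normX z = 1" "dual_normX c = cmod (pairing c z)"
      using dual_normX_is_max by blast
    then show "dual_normX c \<le> cmod (c $ k)"
      using cmod_pairing_le[OF assms k, of z] by simp
  qed (rule cmod_nth_le_dual_normX)
  ultimately show "dual_normX c = norm_inf c" by simp
next
  assume "\<not> make_quadrangle (\<chi> k. cmod (c $ k))"
  then obtain k where k: "(\<Sum>i\<in>UNIV - {k}. cmod (c $ i)) \<le> cmod (c $ k)"
    using assms by (auto simp: make_quadrangle_def not_less)
  have "vX c k \<le> 0"
    using exhaust_4[of k] k assms
    by (auto simp: UNIV_4_diff vX_simps simp del: uminus_add_conv_diff zero_less_norm_iff
        intro!: quadrangle_deficit_nonpos)
  then show "\<exists>k. vX c k \<le> 0" ..
qed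

end
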